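(* Let $K$ be a field and let $q,p_1,\dots,p_n$ be non-zero polynomials in $K[t_1,\dots,t_s]$ such that none of the rational functions $\frac{p_1}{q},\dots,\frac{p_n}{q}$ is constant (i.e. lies in $K$). Let $d=\max\{\deg(q),\deg(p_1),\dots,\deg(p_n)\}$, and let $R=K[x_0,x_1,\dots,x_n,t_1,\dots,t_s,h]$ be graded by $\deg(h)=\deg(t_i)=1$ for $i=1,\dots,s$ and $\deg(x_i)=d$ for $i=0,\dots,n$. Set $Q=q^{\mathrm{hom}_d(h)}$ and $P_i=p_i^{\mathrm{hom}_d(h)}$ for $i=1,\dots,n$. Let $\bar J$ be the homogeneous ideal of $R$ generated by $\{x_0-Q,\ x_1-P_1,\ \dots,\ x_n-P_n\}$. Then: (a) The ideal $\bar J\cap K[x_0,x_1,\dots,x_n]$ is prime. (b) $\mathrm{Implicit}\bigl(\frac{p_1}{q},\dots,\frac{p_n}{q}\bigr)=\bigl(\bar J\cap K[x_0,x_1,\dots,x_n]\bigr)^{\mathrm{deh}(x_0)}$.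
   Context: $t_1,\dots,t_s,h,x_0,x_1,\dots,x_n$ are distinct indeterminates. $\mathrm{Implicit}\bigl(\frac{p_1}{q},\dots,\frac{p_n}{q}\bigr)$ denotes the kernel of the $K$-algebra homomorphism $K[x_1,\dots,x_n]\to K(t_1,\dots,t_s)$ sending $x_i\mapsto\frac{p_i}{q}$ for $i=1,\dots,n$. Degrees of $q,p_i$ are total degrees in $t_1,\dots,t_s$. For a non-zero polynomial $f\in K[t_1,\dots,t_s]$ and an integer $d\ge\deg(f)$, the $d$-shifted-homogenization is $f^{\mathrm{hom}_d(h)}=h^{d-\deg(f)}f^{\mathrm{hom}(h)}$, where $f^{\mathrm{hom}(h)}$ is the usual homogenization of $f$ with respect to $h$; it is homogeneous of degree $d$. For an ideal $I\subseteq K[x_0,\dots,x_n]$, $I^{\mathrm{deh}(x_0)}=\{A(1,x_1,\dots,x_n): A\in I\}\subseteq K[x_1,\dots,x_n]$ is its dehomogenization with respect to $x_0$. *)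

theory Defs
  imports
    "HOL-Library.Poly_Mapping"
    "HOL-Computational_Algebra.Fraction_Field"
    "HOL-Algebra.RingHom"
begin

section \<open>Indeterminates and polynomials\<close>

text \<open>All indeterminates \<open>x\<^sub>i\<close>, \<open>t\<^sub>i\<close>, \<open>h\<close> live in one type, so that the polynomial rings in
  finitely many of them are subrings of one ring, with literal inclusions
  \<open>K[x\<^sub>0,\<dots>,x\<^sub>n] \<subseteq> K[x\<^sub>0,\<dots>,x\<^sub>n,t\<^sub>1,\<dots>,t\<^sub>s,h]\<close>.\<close>

datatype indet = X nat | T nat | H

text \<open>The linear order has no mathematical role: the library's proof that polynomials over a domain
  form a domain (needed for \<^typ>\<open>'a fract\<close>) asks for one on the indeterminates.\<close>

fun indet_code :: "indet \<Rightarrow> nat" where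
  "indet_code H = 0"
| "indet_code (X i) = 2 * i + 1"
| "indet_code (T i) = 2 * i + 2"

lemma indet_code_eq_iff: "indet_code u = indet_code v \<longleftrightarrow> u = v"
  by (cases u; cases v; simp; presburger)

instantiation indet :: linorder
begin

definition less_eq_indet :: "indet \<Rightarrow> indet \<Rightarrow> bool" where
  "u \<le> v \<longleftrightarrow> indet_code u \<le> indet_code v"

definition less_indet :: "indet \<Rightarrow> indet \<Rightarrow> bool" where
  "u < v \<longleftrightarrow> indet_code u < indet_code v"

instance
  by standard (auto simp: less_eq_indet_def less_indet_def indet_code_eq_iff[symmetric])

end

type_synonym monomial = "indet \<Rightarrow>\<^sub>0 nat"
type_synonym 'k mpoly = "monomial \<Rightarrow>\<^sub>0 'k"
type_synonym 'k ratfun = "'k mpoly fract"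

definition mconst :: "'k \<Rightarrow> 'k::comm_ring_1 mpoly" where
  "mconst c = Poly_Mapping.single 0 c"

definition mvar :: "indet \<Rightarrow> 'k::comm_ring_1 mpoly" where
  "mvar v = Poly_Mapping.single (Poly_Mapping.single v 1) 1"

definition indets :: "'k::zero mpoly \<Rightarrow> indet set" where
  "indets f = (\<Union>m \<in> Poly_Mapping.keys f. Poly_Mapping.keys m)"

definition mpoly_ring :: "indet set \<Rightarrow> 'k::comm_ring_1 mpoly ring" where
  "mpoly_ring V = \<lparr>carrier = {f. indets f \<subseteq> V}, mult = (*), one = 1, zero = 0, add = (+)\<rparr>"

definition x_indets :: "nat \<Rightarrow> nat \<Rightarrow> indet set" where
  "x_indets k n = X ` {k..n}"

definition t_indets :: "nat \<Rightarrow> indet set" where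
  "t_indets s = T ` {1..s}"

text \<open>The field of fractions of \<open>K[V]\<close>, as a subfield of the fraction field of the ring of all
  polynomials.\<close>

definition ratfun_field :: "indet set \<Rightarrow> 'k::field ratfun ring" where
  "ratfun_field V =
    \<lparr>carrier = {Fraction_Field.Fract f g | f g.
        f \<in> carrier (mpoly_ring V) \<and> g \<in> carrier (mpoly_ring V) \<and> g \<noteq> 0},
     mult = (*), one = 1, zero = 0, add = (+)\<rparr>"

definition ratconst :: "'k::field \<Rightarrow> 'k ratfun" where
  "ratconst c = Fraction_Field.Fract (mconst c) 1"

text \<open>The algebra homomorphism with \<open>v \<mapsto> \<sigma> v\<close>, the \<open>K\<close>-algebra structure of the target being
  given by \<open>\<phi>\<close>.\<close>

definition eval_hom ::
    "('k::zero \<Rightarrow> 'a) \<Rightarrow> (indet \<Rightarrow> 'a) \<Rightarrow> 'k mpoly \<Rightarrow> 'a::comm_ring_1" where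
  "eval_hom \<phi> \<sigma> f =
    (\<Sum>m \<in> Poly_Mapping.keys f. \<phi> (Poly_Mapping.lookup f m) *
       (\<Prod>v \<in> Poly_Mapping.keys m. \<sigma> v ^ Poly_Mapping.lookup m v))"


section \<open>Degrees, gradings and homogenization\<close>

definition wdeg :: "(indet \<Rightarrow> nat) \<Rightarrow> monomial \<Rightarrow> nat" where
  "wdeg w m = (\<Sum>v \<in> Poly_Mapping.keys m. w v * Poly_Mapping.lookup m v)"

abbreviation mdeg :: "monomial \<Rightarrow> nat" where
  "mdeg \<equiv> wdeg (\<lambda>_. 1)"

text \<open>The total degree, with the junk value 0 for the zero polynomial.\<close>

definition tdeg :: "'k::zero mpoly \<Rightarrow> nat" where
  "tdeg f = Max (insert 0 (mdeg ` Poly_Mapping.keys f))"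

definition homog :: "indet \<Rightarrow> 'k::comm_ring_1 mpoly \<Rightarrow> 'k mpoly" where
  "homog v f = (\<Sum>m \<in> Poly_Mapping.keys f.
     Poly_Mapping.single (m + Poly_Mapping.single v (tdeg f - mdeg m)) (Poly_Mapping.lookup f m))"

text \<open>The subtraction is truncated; the definition is used for \<open>d \<ge> tdeg f\<close> only.\<close>

definition shifted_homog :: "nat \<Rightarrow> indet \<Rightarrow> 'k::comm_ring_1 mpoly \<Rightarrow> 'k mpoly" where
  "shifted_homog d v f = mvar v ^ (d - tdeg f) * homog v f"

fun grading :: "nat \<Rightarrow> indet \<Rightarrow> nat" where
  "grading d (X i) = d"
| "grading d (T i) = 1"
| "grading d H = 1"

definition wcomp :: "(indet \<Rightarrow> nat) \<Rightarrow> nat \<Rightarrow> 'k::comm_ring_1 mpoly \<Rightarrow> 'k mpoly" where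
  "wcomp w j f = (\<Sum>m \<in> {m \<in> Poly_Mapping.keys f. wdeg w m = j}.
     Poly_Mapping.single m (Poly_Mapping.lookup f m))"

definition homogeneous_ideal ::
    "(indet \<Rightarrow> nat) \<Rightarrow> indet set \<Rightarrow> 'k::comm_ring_1 mpoly set \<Rightarrow> bool" where
  "homogeneous_ideal w V I \<longleftrightarrow>
     ideal I (mpoly_ring V) \<and> (\<forall>f \<in> I. \<forall>j. wcomp w j f \<in> I)"

definition dehom :: "nat \<Rightarrow> 'k::comm_ring_1 mpoly set \<Rightarrow> 'k mpoly set" where
  "dehom i I = eval_hom mconst (\<lambda>v. if v = X i then 1 else mvar v) ` I"


section \<open>The implicitization ideals\<close>

definition Implicit :: "nat \<Rightarrow> nat \<Rightarrow> (nat \<Rightarrow> 'k::field mpoly) \<Rightarrow> 'k mpoly \<Rightarrow> 'k mpoly set" where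
  "Implicit n s p q =
     a_kernel (mpoly_ring (x_indets 1 n)) (ratfun_field (t_indets s))
       (eval_hom ratconst (\<lambda>v. case v of X i \<Rightarrow> Fraction_Field.Fract (p i) q | _ \<Rightarrow> 0))"

definition all_indets :: "nat \<Rightarrow> nat \<Rightarrow> indet set" where
  "all_indets n s = x_indets 0 n \<union> t_indets s \<union> {H}"

definition Jbar ::
    "nat \<Rightarrow> nat \<Rightarrow> nat \<Rightarrow> (nat \<Rightarrow> 'k::field mpoly) \<Rightarrow> 'k mpoly \<Rightarrow> 'k mpoly set" where
  "Jbar n s d p q = Idl\<^bsub>mpoly_ring (all_indets n s)\<^esub>
     (insert (mvar (X 0) - shifted_homog d H q)
        ((\<lambda>i. mvar (X i) - shifted_homog d H (p i)) ` {1..n}))"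

section \<open>The polynomial rings are rings, and \<open>Jbar\<close> is homogeneous\<close>

lemma indets_zero [simp]: "indets 0 = {}"
  by (simp add: indets_def)

lemma indets_uminus [simp]: "indets (- f) = indets f" for f :: "'k::comm_ring_1 mpoly"
  by (simp add: indets_def Poly_Mapping.keys_def)

lemma indets_add: "indets (f + g) \<subseteq> indets f \<union> indets g"
  using Poly_Mapping.keys_add[of f g] by (fastforce simp: indets_def)

lemma keys_plus_monomial:
  "Poly_Mapping.keys (m + m') = Poly_Mapping.keys m \<union> Poly_Mapping.keys m'" for m m' :: monomial
  by (auto simp: in_keys_iff lookup_add)

lemma indets_mult: "indets (f * g) \<subseteq> indets f \<union> indets g" for f :: "'k::comm_ring_1 mpoly"
  using keys_mult[of f g] by (fastforce simp: indets_def keys_plus_monomial)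

lemma indets_one [simp]: "indets (1 :: 'k::comm_ring_1 mpoly) = {}"
  by (simp add: indets_def)

lemma indets_sum: "finite A \<Longrightarrow> indets (sum F A) \<subseteq> (\<Union>a \<in> A. indets (F a))"
  by (induction A rule: finite_induct) (use indets_add in \<open>fastforce+\<close>)

lemma indets_power: "indets (f ^ k) \<subseteq> indets f" for f :: "'k::comm_ring_1 mpoly"
  by (induction k) (use indets_mult in \<open>fastforce+\<close>)

lemma indets_single: "indets (Poly_Mapping.single m c) \<subseteq> Poly_Mapping.keys m"
  by (simp add: indets_def)

lemma indets_mvar: "indets (mvar v :: 'k::comm_ring_1 mpoly) = {v}"
  by (simp add: indets_def mvar_def)

lemma mpoly_ring_simps [simp]:
  "f \<in> carrier (mpoly_ring V) \<longleftrightarrow> indets f \<subseteq> V"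
  "mult (mpoly_ring V) = (*)" "add (mpoly_ring V) = (+)"
  "one (mpoly_ring V) = 1" "zero (mpoly_ring V) = 0"
  by (simp_all add: mpoly_ring_def)

lemma cring_mpoly_ring: "cring (mpoly_ring V :: 'k::comm_ring_1 mpoly ring)"
proof (rule cringI)
  show "abelian_group (mpoly_ring V :: 'k mpoly ring)"
  proof (rule abelian_groupI)
    fix f :: "'k mpoly" assume "f \<in> carrier (mpoly_ring V)"
    then show "\<exists>g \<in> carrier (mpoly_ring V). g \<oplus>\<^bsub>mpoly_ring V\<^esub> f = \<zero>\<^bsub>mpoly_ring V\<^esub>"
      by (intro bexI[of _ "- f"]) auto
  qed (use indets_add in \<open>fastforce simp: algebra_simps\<close>)+
  show "Group.comm_monoid (mpoly_ring V :: 'k mpoly ring)"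
    by (rule Group.comm_monoidI) (use indets_mult in \<open>fastforce simp: algebra_simps\<close>)+
qed (simp add: algebra_simps)

lemma a_inv_mpoly_ring:
  assumes "indets f \<subseteq> V"
  shows "a_inv (mpoly_ring V) f = - (f :: 'k::comm_ring_1 mpoly)"
proof -
  interpret cring "mpoly_ring V :: 'k mpoly ring" by (rule cring_mpoly_ring)
  show ?thesis using assms by (intro minus_equality) auto
qed

lemma wdeg_eq:
  assumes "finite A" "Poly_Mapping.keys m \<subseteq> A"
  shows "wdeg w m = (\<Sum>v \<in> A. w v * Poly_Mapping.lookup m v)"
  unfolding wdeg_def using assms
  by (intro sum.mono_neutral_left) (auto simp: in_keys_iff)

lemma wdeg_add: "wdeg w (m + m') = wdeg w m + wdeg w m'"
proof -
  let ?A = "Poly_Mapping.keys m \<union> Poly_Mapping.keys m'"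
  have "wdeg w m = (\<Sum>v \<in> ?A. w v * Poly_Mapping.lookup m v)"
    "wdeg w m' = (\<Sum>v \<in> ?A. w v * Poly_Mapping.lookup m' v)"
    "wdeg w (m + m') = (\<Sum>v \<in> ?A. w v * Poly_Mapping.lookup (m + m') v)"
    by (intro wdeg_eq; simp add: keys_plus_monomial)+
  then show ?thesis
    by (simp add: lookup_add algebra_simps sum.distrib)
qed

lemma wdeg_single [simp]: "wdeg w (Poly_Mapping.single v k) = w v * k"
  by (simp add: wdeg_def)

lemma wdeg_cong:
  "(\<And>v. v \<in> Poly_Mapping.keys m \<Longrightarrow> w v = w' v) \<Longrightarrow> wdeg w m = wdeg w' m"
  unfolding wdeg_def by (intro sum.cong) auto

lemma lookup_wcomp:
  "Poly_Mapping.lookup (wcomp w j f) m = (if wdeg w m = j then Poly_Mapping.lookup f m else 0)"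
proof -
  let ?S = "{m \<in> Poly_Mapping.keys f. wdeg w m = j}"
  have "Poly_Mapping.lookup (wcomp w j f) m =
      (\<Sum>m' \<in> ?S. if m' = m then Poly_Mapping.lookup f m' else 0)"
    unfolding wcomp_def lookup_sum by (intro sum.cong) (auto simp: lookup_single when_def)
  then show ?thesis
    by (simp add: in_keys_iff)
qed

lemma wcomp_add: "wcomp w j (f + g) = wcomp w j f + wcomp w j g"
  by (rule poly_mapping_eqI) (simp add: lookup_wcomp lookup_add)

lemma wcomp_uminus: "wcomp w j (- f) = - wcomp w j f"
  by (rule poly_mapping_eqI) (simp add: lookup_wcomp)

lemma wcomp_zero: "wcomp w j 0 = 0"
  by (rule poly_mapping_eqI) (simp add: lookup_wcomp)

lemma wcomp_sum: "finite A \<Longrightarrow> wcomp w j (sum F A) = (\<Sum>a \<in> A. wcomp w j (F a))"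
  by (induction A rule: finite_induct) (simp_all add: wcomp_zero wcomp_add)

lemma mpoly_eq_sum:
  "f = (\<Sum>m \<in> Poly_Mapping.keys f. Poly_Mapping.single m (Poly_Mapping.lookup f m))"
  by (rule poly_mapping_eqI) (simp add: lookup_sum lookup_single when_def in_keys_iff)

lemma wcomp_single:
  "wcomp w j (Poly_Mapping.single m c) = (if wdeg w m = j then Poly_Mapping.single m c else 0)"
  by (rule poly_mapping_eqI) (auto simp: lookup_wcomp lookup_single when_def)

lemma wcomp_single_mult:
  "wcomp w j (Poly_Mapping.single m c * f) =
     (if wdeg w m \<le> j then Poly_Mapping.single m c * wcomp w (j - wdeg w m) f else 0)"
proof -
  have "wcomp w j (Poly_Mapping.single m c * f) = (\<Sum>m' \<in> Poly_Mapping.keys f.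
      wcomp w j (Poly_Mapping.single (m + m') (c * Poly_Mapping.lookup f m')))"
    by (subst mpoly_eq_sum[of f]) (simp add: sum_distrib_left mult_single wcomp_sum)
  also have "\<dots> = (\<Sum>m' \<in> Poly_Mapping.keys f. if wdeg w m \<le> j then Poly_Mapping.single m c *
      wcomp w (j - wdeg w m) (Poly_Mapping.single m' (Poly_Mapping.lookup f m')) else 0)"
    by (intro sum.cong) (auto simp: wcomp_single wdeg_add mult_single)
  also have "\<dots> = (if wdeg w m \<le> j then Poly_Mapping.single m c *
      wcomp w (j - wdeg w m) (\<Sum>m' \<in> Poly_Mapping.keys f.
        Poly_Mapping.single m' (Poly_Mapping.lookup f m')) else 0)"
    by (simp add: wcomp_sum sum_distrib_left)
  finally show ?thesis
    by (simp add: mpoly_eq_sum[of f, symmetric])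
qed

text \<open>An ideal generated by homogeneous elements is homogeneous.\<close>

lemma homogeneous_ideal_genideal:
  fixes S :: "'k::comm_ring_1 mpoly set"
  assumes S: "S \<subseteq> carrier (mpoly_ring V)"
    and hom: "\<And>f. f \<in> S \<Longrightarrow> \<exists>k. \<forall>m \<in> Poly_Mapping.keys f. wdeg w m = k"
  shows "homogeneous_ideal w V (Idl\<^bsub>mpoly_ring V\<^esub> S)"
proof -
  interpret cring "mpoly_ring V :: 'k mpoly ring" by (rule cring_mpoly_ring)
  let ?I = "Idl\<^bsub>mpoly_ring V\<^esub> S"
  interpret I: ideal ?I "mpoly_ring V" by (rule genideal_ideal[OF S])
  have zeroI: "0 \<in> ?I" using I.zero_closed by simp
  have addI: "f + g \<in> ?I" if "f \<in> ?I" "g \<in> ?I" for f g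
    using I.a_closed[OF that] by simp
  have multI: "r * f \<in> ?I" if "f \<in> ?I" "indets r \<subseteq> V" for f r
    using I.I_l_closed[of f r] that by simp
  have carI: "indets f \<subseteq> V" if "f \<in> ?I" for f
    using I.a_subset that by force
  have negI: "- f \<in> ?I" if "f \<in> ?I" for f
    using multI[OF that, of "- 1"] by simp
  have sumI: "sum F A \<in> ?I" if "finite A" "\<And>a. a \<in> A \<Longrightarrow> F a \<in> ?I" for F :: "monomial \<Rightarrow> _" and A
    using that by (induction A rule: finite_induct) (auto intro: zeroI addI)
  define I' where "I' = {f \<in> ?I. \<forall>j. wcomp w j f \<in> ?I}"
  have mult': "r * f \<in> I'" if f: "f \<in> I'" and r: "indets r \<subseteq> V" for f r
  proof -
    have "wcomp w j (r * f) \<in> ?I" for j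
    proof -
      have "wcomp w j (r * f) = (\<Sum>m \<in> Poly_Mapping.keys r.
          wcomp w j (Poly_Mapping.single m (Poly_Mapping.lookup r m) * f))"
        by (subst mpoly_eq_sum[of r]) (simp add: sum_distrib_right wcomp_sum)
      also have "\<dots> \<in> ?I"
      proof (rule sumI)
        fix m assume m: "m \<in> Poly_Mapping.keys r"
        have "indets (Poly_Mapping.single m (Poly_Mapping.lookup r m)) \<subseteq> V"
          using m r indets_single[of m "Poly_Mapping.lookup r m"] by (auto simp: indets_def)
        then show "wcomp w j (Poly_Mapping.single m (Poly_Mapping.lookup r m) * f) \<in> ?I"
          using f zeroI by (auto simp: wcomp_single_mult I'_def intro: multI)
      qed simp
      finally show ?thesis .
    qed
    then show ?thesis
      using f r by (auto simp: I'_def intro: multI)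
  qed
  have "ideal I' (mpoly_ring V)"
  proof (rule idealI)
    show "subgroup I' (add_monoid (mpoly_ring V))"
    proof (rule group.subgroupI)
      show "group (add_monoid (mpoly_ring V :: 'k mpoly ring))"
        by (rule a_group)
      show "I' \<subseteq> carrier (add_monoid (mpoly_ring V))"
        using carI by (auto simp: I'_def mpoly_ring_def)
      show "I' \<noteq> {}"
        using zeroI by (auto simp: I'_def wcomp_zero)
      fix f assume f: "f \<in> I'"
      then have "inv\<^bsub>add_monoid (mpoly_ring V)\<^esub> f = - f"
        using a_inv_mpoly_ring[OF carI, of f] by (auto simp: I'_def a_inv_def)
      then show "inv\<^bsub>add_monoid (mpoly_ring V)\<^esub> f \<in> I'"
        using f negI by (auto simp: I'_def wcomp_uminus)
      fix g assume "g \<in> I'"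
      then show "f \<otimes>\<^bsub>add_monoid (mpoly_ring V)\<^esub> g \<in> I'"
        using f addI by (auto simp: I'_def wcomp_add)
    qed
  qed (use mult' in \<open>auto simp: mult.commute ring_axioms\<close>)
  moreover have "S \<subseteq> I'"
  proof
    fix f assume f: "f \<in> S"
    then have fI: "f \<in> ?I" using genideal_self[OF S] by blast
    obtain k where "\<forall>m \<in> Poly_Mapping.keys f. wdeg w m = k" using hom f by blast
    then have "wcomp w j f = (if j = k then f else 0)" for j
      by (intro poly_mapping_eqI) (auto simp: lookup_wcomp in_keys_iff)
    then show "f \<in> I'" using fI zeroI by (auto simp: I'_def)
  qed
  ultimately have "?I \<subseteq> I'" by (rule genideal_minimal)
  then show ?thesis
    using I.is_ideal by (auto simp: homogeneous_ideal_def I'_def)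
qed

lemma mvar_power:
  "(mvar v :: 'k::comm_ring_1 mpoly) ^ k = Poly_Mapping.single (Poly_Mapping.single v k) 1"
  by (induction k) (simp_all add: mvar_def mult_single flip: single_add)

lemma mdeg_le_tdeg: "m \<in> Poly_Mapping.keys f \<Longrightarrow> mdeg m \<le> tdeg f"
  unfolding tdeg_def by (intro Max_ge) auto

lemma shifted_homog_eq:
  assumes "tdeg f \<le> d"
  shows "shifted_homog d v f = (\<Sum>m \<in> Poly_Mapping.keys f.
     Poly_Mapping.single (m + Poly_Mapping.single v (d - mdeg m)) (Poly_Mapping.lookup f m))"
  unfolding shifted_homog_def homog_def mvar_power sum_distrib_left mult_single
proof (intro sum.cong refl)
  fix m assume "m \<in> Poly_Mapping.keys f"
  then have "d - mdeg m = (d - tdeg f) + (tdeg f - mdeg m)"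
    using mdeg_le_tdeg[of m f] assms by simp
  then have "Poly_Mapping.single v (d - tdeg f) + (m + Poly_Mapping.single v (tdeg f - mdeg m))
      = m + Poly_Mapping.single v (d - mdeg m)"
    by (metis add.left_commute single_add)
  then show "Poly_Mapping.single (Poly_Mapping.single v (d - tdeg f) +
        (m + Poly_Mapping.single v (tdeg f - mdeg m))) (1 * Poly_Mapping.lookup f m) =
      Poly_Mapping.single (m + Poly_Mapping.single v (d - mdeg m)) (Poly_Mapping.lookup f m)"
    by simp
qed

lemma shifted_homog_keys:
  assumes "tdeg f \<le> d" "m \<in> Poly_Mapping.keys (shifted_homog d v f)"
  obtains m' where "m' \<in> Poly_Mapping.keys f" "mdeg m' \<le> d"
    "m = m' + Poly_Mapping.single v (d - mdeg m')"
proof -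
  from assms(2) obtain m' where "m' \<in> Poly_Mapping.keys f"
    "m = m' + Poly_Mapping.single v (d - mdeg m')"
    unfolding shifted_homog_eq[OF assms(1)]
    using keys_sum[of "\<lambda>m. Poly_Mapping.single (m + Poly_Mapping.single v (d - mdeg m))
      (Poly_Mapping.lookup f m)" "Poly_Mapping.keys f"]
    by (fastforce split: if_splits)
  then show thesis
    using that mdeg_le_tdeg[of m' f] assms(1) by fastforce
qed

theorem homogeneous_ideal_Jbar:
  fixes q :: "'k::field mpoly"
  assumes "q \<in> carrier (mpoly_ring (t_indets s))" "tdeg q \<le> d"
    and "\<forall>i \<in> {1..n}. p i \<in> carrier (mpoly_ring (t_indets s)) \<and> tdeg (p i) \<le> d"
  shows "homogeneous_ideal (grading d) (all_indets n s) (Jbar n s d p q)"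
proof -
  let ?g = "\<lambda>i f. mvar (X i) - shifted_homog d H f :: 'k mpoly"
  have keys_g: "m = Poly_Mapping.single (X i) 1 \<or> (\<exists>m' \<in> Poly_Mapping.keys f. mdeg m' \<le> d \<and>
      m = m' + Poly_Mapping.single H (d - mdeg m'))"
    if "m \<in> Poly_Mapping.keys (?g i f)" "tdeg f \<le> d" for i f m
  proof -
    have "m \<in> Poly_Mapping.keys (mvar (X i) :: 'k mpoly) \<or>
        m \<in> Poly_Mapping.keys (shifted_homog d H f)"
      using that(1) by (auto simp: in_keys_iff lookup_minus)
    then show ?thesis
      using shifted_homog_keys[OF that(2), of m H] by (auto simp: mvar_def)
  qed
  have car: "indets (?g i f) \<subseteq> all_indets n s"
    if "i \<le> n" "indets f \<subseteq> t_indets s" "tdeg f \<le> d" for i f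
  proof
    fix v assume "v \<in> indets (?g i f)"
    then obtain m where m: "m \<in> Poly_Mapping.keys (?g i f)" "v \<in> Poly_Mapping.keys m"
      by (auto simp: indets_def)
    from keys_g[OF m(1) that(3)] show "v \<in> all_indets n s"
    proof
      assume "m = Poly_Mapping.single (X i) 1"
      then show ?thesis using m(2) that(1) by (auto simp: all_indets_def x_indets_def)
    next
      assume "\<exists>m' \<in> Poly_Mapping.keys f. mdeg m' \<le> d \<and>
        m = m' + Poly_Mapping.single H (d - mdeg m')"
      then obtain m' where "m' \<in> Poly_Mapping.keys f" "v \<in> Poly_Mapping.keys m' \<or> v = H"
        using m(2) by (auto simp: keys_plus_monomial split: if_splits)
      then show ?thesis using that(2) by (auto simp: all_indets_def indets_def)
    qed
  qed
  have hom: "\<forall>m \<in> Poly_Mapping.keys (?g i f). wdeg (grading d) m = d"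
    if "indets f \<subseteq> t_indets s" "tdeg f \<le> d" for i f
  proof
    fix m assume "m \<in> Poly_Mapping.keys (?g i f)"
    from keys_g[OF this that(2)] show "wdeg (grading d) m = d"
    proof
      assume "\<exists>m' \<in> Poly_Mapping.keys f. mdeg m' \<le> d \<and>
        m = m' + Poly_Mapping.single H (d - mdeg m')"
      then obtain m' where m': "m' \<in> Poly_Mapping.keys f" "mdeg m' \<le> d"
        "m = m' + Poly_Mapping.single H (d - mdeg m')" by blast
      have "grading d v = 1" if "v \<in> Poly_Mapping.keys m'" for v
        using that m'(1) \<open>indets f \<subseteq> t_indets s\<close> by (fastforce simp: indets_def t_indets_def)
      then have "wdeg (grading d) m' = mdeg m'" by (intro wdeg_cong) auto
      then show ?thesis using m'(2,3) by (simp add: wdeg_add)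
    qed simp
  qed
  show ?thesis
    unfolding Jbar_def
  proof (rule homogeneous_ideal_genideal)
    show "insert (?g 0 q) ((\<lambda>i. ?g i (p i)) ` {1..n}) \<subseteq> carrier (mpoly_ring (all_indets n s))"
      using assms car by auto
    show "\<exists>k. \<forall>m \<in> Poly_Mapping.keys f. wdeg (grading d) m = k"
      if "f \<in> insert (?g 0 q) ((\<lambda>i. ?g i (p i)) ` {1..n})" for f
      using that assms hom by (intro exI[of _ d]) (auto simp del: One_nat_def)
  qed
qed

end

theory Submission
  imports Defs "HOL-Algebra.QuotRing"
begin

text \<open>
  Write \<open>Q\<close>, \<open>P\<^sub>i\<close> for the \<open>d\<close>-shifted homogenizations of \<open>q\<close>, \<open>p\<^sub>i\<close>, and let \<open>\<Psi>\<close> be the substitution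
  \<open>x\<^sub>0 \<mapsto> Q\<close>, \<open>x\<^sub>i \<mapsto> P\<^sub>i\<close> that fixes \<open>t\<^sub>1,\<dots>,t\<^sub>s,h\<close>. Modulo \<open>Jbar\<close> every polynomial is congruent to its
  image under \<open>\<Psi>\<close>, so \<open>Jbar\<close> is the kernel of \<open>\<Psi>\<close> (\<open>graph_ideal_eq_kernel\<close>). The target of \<open>\<Psi>\<close> is a
  domain, so the part of the kernel in \<open>K[x\<^sub>0,\<dots>,x\<^sub>n]\<close> is prime.

  The link with the implicitization is Euler's scaling rule: if \<open>A\<close> is a form of degree \<open>N\<close> in
  \<open>x\<^sub>0,\<dots>,x\<^sub>n\<close>, then \<open>A(q,p\<^sub>1,\<dots>,p\<^sub>n) = q\<^sup>N A(1,p\<^sub>1/q,\<dots>,p\<^sub>n/q)\<close>, and the left-hand side is \<open>\<Psi> A\<close> at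
  \<open>h = 1\<close> (\<open>eval_form_at_quotients\<close>).

  Let \<open>A\<close> be in \<open>Jbar \<inter> K[x\<^sub>0,\<dots>,x\<^sub>n]\<close>. As \<open>Jbar\<close> is homogeneous, the homogeneous components of \<open>A\<close> lie
  in \<open>Jbar\<close> too. They are forms in the usual sense because every \<open>x\<^sub>i\<close> has the same degree \<open>d\<close>, which
  is positive: otherwise all \<open>p\<^sub>i/q\<close> would be constant. The scaling rule applies to each component
  and shows that \<open>A(1,x\<^sub>1,\<dots>,x\<^sub>n)\<close> vanishes at the \<open>p\<^sub>i/q\<close>.

  Conversely, let \<open>f\<close> vanish at the \<open>p\<^sub>i/q\<close> and let \<open>F\<close> be its homogenization with respect to \<open>x\<^sub>0\<close>.
  By the scaling rule \<open>\<Psi> F\<close> vanishes at \<open>h = 1\<close>. Now \<open>\<Psi> F\<close> is itself a form in \<open>t\<^sub>1,\<dots>,t\<^sub>s,h\<close>, and a form of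
  given degree is determined by its dehomogenization (\<open>set_one_eq_0_form\<close>, again by scaling). Hence \<open>\<Psi> F = 0\<close>, so
  \<open>F\<close> lies in \<open>Jbar\<close>, and dehomogenizing \<open>F\<close> gives back \<open>f\<close>.
\<close>

section \<open>Evaluation homomorphisms\<close>

text \<open>Homomorphisms between whole types. All maps below (coefficient embeddings, substitutions,
  evaluation in the field of fractions) are of this kind, so they compose, and two of them agree on a
  polynomial as soon as they agree on constants and on its indeterminates.\<close>

locale unital_hom =
  fixes \<chi> :: "'a::comm_ring_1 \<Rightarrow> 'b::comm_ring_1"
  assumes hom_add: "\<chi> (x + y) = \<chi> x + \<chi> y"
    and hom_mult: "\<chi> (x * y) = \<chi> x * \<chi> y"
    and hom_one: "\<chi> 1 = 1"
begin

lemma hom_zero: "\<chi> 0 = 0"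
  using hom_add[of 0 0] by simp

lemma hom_minus: "\<chi> (x - y) = \<chi> x - \<chi> y"
  using hom_add[of "x - y" y] by simp

lemma hom_power: "\<chi> (x ^ k) = \<chi> x ^ k"
  by (induction k) (simp_all add: hom_one hom_mult)

lemma hom_sum: "\<chi> (sum F A) = (\<Sum>a \<in> A. \<chi> (F a))"
  by (induction A rule: infinite_finite_induct) (simp_all add: hom_zero hom_add)

end

lemma unital_hom_comp:
  assumes "unital_hom \<chi>" "unital_hom \<psi>"
  shows "unital_hom (\<lambda>x. \<psi> (\<chi> x))"
  using assms by (simp add: unital_hom_def)

lemma unital_hom_id: "unital_hom (\<lambda>x. x)"
  by (simp add: unital_hom_def)

lemma unital_hom_mconst: "unital_hom (mconst :: 'k::comm_ring_1 \<Rightarrow> 'k mpoly)"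
  by standard (simp_all add: mconst_def single_add mult_single)

lemma unital_hom_Fract:
  "unital_hom (\<lambda>f :: 'a::idom. Fraction_Field.Fract f 1)"
  by standard (simp_all add: One_fract_def)

lemma ratconst_eq: "ratconst = (\<lambda>c. Fraction_Field.Fract (mconst c) 1)"
  by (simp add: ratconst_def fun_eq_iff)

lemma unital_hom_ratconst: "unital_hom (ratconst :: 'k::field \<Rightarrow> 'k ratfun)"
  unfolding ratconst_eq by (rule unital_hom_comp[OF unital_hom_mconst unital_hom_Fract])

lemma Fract_eq_0_iff: "Fraction_Field.Fract f 1 = 0 \<longleftrightarrow> f = (0 :: 'a::idom)"
  by (simp add: Zero_fract_def eq_fract)

lemma prod_single_one:
  "(\<Prod>v \<in> A. Poly_Mapping.single (F v) (1 :: 'k::comm_ring_1)) =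
    Poly_Mapping.single (\<Sum>v \<in> A. F v :: monomial) 1"
  by (induction A rule: infinite_finite_induct) (simp_all add: mult_single)

lemma single_eq_prod:
  "Poly_Mapping.single m (c :: 'k::comm_ring_1) =
    mconst c * (\<Prod>v \<in> Poly_Mapping.keys m. mvar v ^ Poly_Mapping.lookup m v)"
proof -
  have "(\<Prod>v \<in> Poly_Mapping.keys m. mvar v ^ Poly_Mapping.lookup m v) =
      Poly_Mapping.single m (1 :: 'k)"
    by (simp add: mvar_power prod_single_one mpoly_eq_sum[of m, symmetric])
  then show ?thesis by (simp add: mconst_def mult_single)
qed

lemma mpoly_induct [consumes 1, case_names const var add mult]:
  fixes f :: "'k::comm_ring_1 mpoly"
  assumes f: "indets f \<subseteq> V"
    and const: "\<And>c. Q (mconst c)" and var: "\<And>v. v \<in> V \<Longrightarrow> Q (mvar v)"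
    and add: "\<And>f g. Q f \<Longrightarrow> Q g \<Longrightarrow> Q (f + g)"
    and mult: "\<And>f g. Q f \<Longrightarrow> Q g \<Longrightarrow> Q (f * g)"
  shows "Q f"
proof -
  interpret const: unital_hom "mconst :: 'k \<Rightarrow> 'k mpoly" by (rule unital_hom_mconst)
  have Q01: "Q 0" "Q 1"
    using const[of 0] const[of 1] by (simp_all add: const.hom_zero const.hom_one)
  have pow: "Q (mvar v ^ k)" if "v \<in> V" for v k
    using that by (induction k) (auto intro: Q01 var mult)
  have prods: "Q (\<Prod>v \<in> A. mvar v ^ k v)" if "finite A" "A \<subseteq> V" for A k
    using that by (induction A rule: finite_induct) (auto intro: Q01 pow mult)
  have sums: "Q (sum F A)" if "finite A" "\<And>a. a \<in> A \<Longrightarrow> Q (F a)" for F and A :: "monomial set"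
    using that by (induction A rule: finite_induct) (auto intro: Q01 add)
  have "Q (\<Sum>m \<in> Poly_Mapping.keys f. Poly_Mapping.single m (Poly_Mapping.lookup f m))"
    unfolding single_eq_prod using f by (intro sums mult const prods) (auto simp: indets_def)
  then show ?thesis by (simp add: mpoly_eq_sum[of f, symmetric])
qed

text \<open>The universal property of polynomial rings, in the form in which identities between
  compositions of evaluations are proved: only finitely many values on indeterminates matter.\<close>

lemma unital_hom_cong_indets:
  fixes f :: "'k::comm_ring_1 mpoly"
  assumes "unital_hom \<chi>" "unital_hom \<psi>" "\<And>c. \<chi> (mconst c) = \<psi> (mconst c)"
    and "\<And>v. v \<in> indets f \<Longrightarrow> \<chi> (mvar v) = \<psi> (mvar v)"
  shows "\<chi> f = \<psi> f"
  by (rule mpoly_induct[OF order.refl, where f = f])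
    (use assms in \<open>auto simp: unital_hom.hom_add unital_hom.hom_mult\<close>)

definition monom_eval :: "(indet \<Rightarrow> 'a) \<Rightarrow> monomial \<Rightarrow> 'a::comm_ring_1" where
  "monom_eval \<sigma> m = (\<Prod>v \<in> Poly_Mapping.keys m. \<sigma> v ^ Poly_Mapping.lookup m v)"

lemma monom_eval_eq:
  assumes "finite A" "Poly_Mapping.keys m \<subseteq> A"
  shows "monom_eval \<sigma> m = (\<Prod>v \<in> A. \<sigma> v ^ Poly_Mapping.lookup m v)"
  unfolding monom_eval_def using assms
  by (intro prod.mono_neutral_left) (auto simp: in_keys_iff)

lemma monom_eval_add: "monom_eval \<sigma> (m + m') = monom_eval \<sigma> m * monom_eval \<sigma> m'"
proof -
  let ?A = "Poly_Mapping.keys m \<union> Poly_Mapping.keys m'"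
  have "monom_eval \<sigma> m = (\<Prod>v \<in> ?A. \<sigma> v ^ Poly_Mapping.lookup m v)"
    "monom_eval \<sigma> m' = (\<Prod>v \<in> ?A. \<sigma> v ^ Poly_Mapping.lookup m' v)"
    "monom_eval \<sigma> (m + m') = (\<Prod>v \<in> ?A. \<sigma> v ^ Poly_Mapping.lookup (m + m') v)"
    by (intro monom_eval_eq; simp add: keys_plus_monomial)+
  then show ?thesis
    by (simp add: lookup_add power_add prod.distrib)
qed

text \<open>Padding the sum with zero terms lets two polynomials be evaluated over a common set of
  monomials.\<close>

lemma eval_hom_eq:
  assumes "unital_hom \<phi>" "finite A" "Poly_Mapping.keys f \<subseteq> A"
  shows "eval_hom \<phi> \<sigma> f = (\<Sum>m \<in> A. \<phi> (Poly_Mapping.lookup f m) * monom_eval \<sigma> m)"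
  unfolding eval_hom_def monom_eval_def[symmetric] using assms
  by (intro sum.mono_neutral_left) (auto simp: in_keys_iff unital_hom.hom_zero)

lemma eval_hom_single:
  assumes "unital_hom \<phi>"
  shows "eval_hom \<phi> \<sigma> (Poly_Mapping.single m c) = \<phi> c * monom_eval \<sigma> m"
  by (subst eval_hom_eq[OF assms, of "{m}"]) simp_all

lemma eval_hom_mconst:
  assumes "unital_hom \<phi>"
  shows "eval_hom \<phi> \<sigma> (mconst c) = \<phi> c"
  by (simp add: mconst_def eval_hom_single[OF assms] monom_eval_def)

lemma eval_hom_mvar:
  assumes "unital_hom \<phi>"
  shows "eval_hom \<phi> \<sigma> (mvar v) = \<sigma> v"
  by (simp add: mvar_def eval_hom_single[OF assms] monom_eval_def unital_hom.hom_one[OF assms])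

lemma unital_hom_eval_hom:
  fixes \<phi> :: "'k::comm_ring_1 \<Rightarrow> 'a::comm_ring_1"
  assumes "unital_hom \<phi>"
  shows "unital_hom (eval_hom \<phi> \<sigma>)"
proof -
  interpret \<phi>: unital_hom \<phi> by fact
  have add: "eval_hom \<phi> \<sigma> (f + g) = eval_hom \<phi> \<sigma> f + eval_hom \<phi> \<sigma> g" for f g
  proof -
    let ?A = "Poly_Mapping.keys f \<union> Poly_Mapping.keys g"
    have "Poly_Mapping.keys (f + g) \<subseteq> ?A" by (rule Poly_Mapping.keys_add)
    then show ?thesis
      by (simp add: eval_hom_eq[OF assms, of ?A] lookup_add \<phi>.hom_add distrib_right sum.distrib)
  qed
  have zero: "eval_hom \<phi> \<sigma> 0 = 0"
    by (simp add: eval_hom_def)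
  have sum: "eval_hom \<phi> \<sigma> (sum F A) = (\<Sum>a \<in> A. eval_hom \<phi> \<sigma> (F a))" for F and A :: "monomial set"
    by (induction A rule: infinite_finite_induct) (simp_all add: zero add)
  have mult: "eval_hom \<phi> \<sigma> (f * g) = eval_hom \<phi> \<sigma> f * eval_hom \<phi> \<sigma> g" for f g
  proof -
    have "eval_hom \<phi> \<sigma> (f * g) = eval_hom \<phi> \<sigma>
        ((\<Sum>m \<in> Poly_Mapping.keys f. Poly_Mapping.single m (Poly_Mapping.lookup f m)) *
         (\<Sum>m \<in> Poly_Mapping.keys g. Poly_Mapping.single m (Poly_Mapping.lookup g m)))"
      by (simp add: mpoly_eq_sum[of f, symmetric] mpoly_eq_sum[of g, symmetric])
    also have "\<dots> = (\<Sum>m \<in> Poly_Mapping.keys f. \<phi> (Poly_Mapping.lookup f m) * monom_eval \<sigma> m) *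
        (\<Sum>m \<in> Poly_Mapping.keys g. \<phi> (Poly_Mapping.lookup g m) * monom_eval \<sigma> m)"
      by (simp add: sum_product sum mult_single eval_hom_single[OF assms] \<phi>.hom_mult
          monom_eval_add mult.assoc mult.left_commute)
    finally show ?thesis by (simp only: eval_hom_eq[OF assms finite_keys order.refl])
  qed
  have "eval_hom \<phi> \<sigma> 1 = 1"
    using eval_hom_mconst[OF assms, of \<sigma> 1] by (simp add: mconst_def \<phi>.hom_one)
  then show ?thesis using add mult by unfold_locales
qed

lemmas eval_mconst_simps =
  eval_hom_mconst[OF unital_hom_mconst] eval_hom_mvar[OF unital_hom_mconst]

lemma eval_hom_mvar_ident:
  fixes f :: "'k::comm_ring_1 mpoly"
  assumes "\<And>v. v \<in> indets f \<Longrightarrow> \<sigma> v = mvar v"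
  shows "eval_hom mconst \<sigma> f = f"
  by (rule unital_hom_cong_indets[OF unital_hom_eval_hom[OF unital_hom_mconst] unital_hom_id])
    (simp_all add: eval_mconst_simps assms)

lemma Fract_eq_eval_hom:
  fixes f :: "'k::field mpoly"
  shows "Fraction_Field.Fract f 1 = eval_hom ratconst (\<lambda>v. Fraction_Field.Fract (mvar v) 1) f"
  by (rule unital_hom_cong_indets[OF unital_hom_Fract unital_hom_eval_hom[OF unital_hom_ratconst]])
    (simp_all add: eval_hom_mconst[OF unital_hom_ratconst] eval_hom_mvar[OF unital_hom_ratconst]
      ratconst_def)

lemma indets_mconst [simp]: "indets (mconst c :: 'k::comm_ring_1 mpoly) = {}"
  by (simp add: indets_def mconst_def)

lemma indets_diff:
  fixes f g :: "'k::comm_ring_1 mpoly"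
  shows "indets (f - g) \<subseteq> indets f \<union> indets g"
  using indets_add[of f "- g"] by simp

lemma indets_eval_hom:
  fixes f :: "'k::comm_ring_1 mpoly"
  assumes "\<And>v. v \<in> indets f \<Longrightarrow> indets (\<sigma> v) \<subseteq> W"
  shows "indets (eval_hom mconst \<sigma> f) \<subseteq> W"
proof -
  interpret unital_hom "eval_hom mconst \<sigma> :: 'k mpoly \<Rightarrow> 'k mpoly"
    by (rule unital_hom_eval_hom[OF unital_hom_mconst])
  show ?thesis
  proof (rule mpoly_induct[OF order.refl, where f = f])
    show "indets (eval_hom mconst \<sigma> (f + g)) \<subseteq> W"
      if "indets (eval_hom mconst \<sigma> f) \<subseteq> W" "indets (eval_hom mconst \<sigma> g) \<subseteq> W" for f g
      using that indets_add[of "eval_hom mconst \<sigma> f" "eval_hom mconst \<sigma> g"]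
      by (auto simp: hom_add)
    show "indets (eval_hom mconst \<sigma> (f * g)) \<subseteq> W"
      if "indets (eval_hom mconst \<sigma> f) \<subseteq> W" "indets (eval_hom mconst \<sigma> g) \<subseteq> W" for f g
      using that indets_mult[of "eval_hom mconst \<sigma> f" "eval_hom mconst \<sigma> g"]
      by (auto simp: hom_mult)
  qed (use assms in \<open>auto simp: eval_mconst_simps\<close>)
qed

section \<open>Forms, homogenization and dehomogenization\<close>

text \<open>Euler's scaling rule: each monomial of degree \<open>N\<close> contributes exactly one factor \<open>c\<close> per
  indeterminate, counted with multiplicity.\<close>

lemma eval_hom_form_scale:
  assumes form: "\<forall>m \<in> Poly_Mapping.keys A. mdeg m = N"
    and scale: "\<And>v. v \<in> indets A \<Longrightarrow> \<sigma> v = c * \<tau> v"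
  shows "eval_hom \<phi> \<sigma> A = c ^ N * eval_hom \<phi> \<tau> A"
proof -
  have "(\<Prod>v \<in> Poly_Mapping.keys m. \<sigma> v ^ Poly_Mapping.lookup m v) =
      c ^ N * (\<Prod>v \<in> Poly_Mapping.keys m. \<tau> v ^ Poly_Mapping.lookup m v)"
    if m: "m \<in> Poly_Mapping.keys A" for m
  proof -
    have "(\<Prod>v \<in> Poly_Mapping.keys m. \<sigma> v ^ Poly_Mapping.lookup m v) =
        (\<Prod>v \<in> Poly_Mapping.keys m. (c * \<tau> v) ^ Poly_Mapping.lookup m v)"
      using m by (intro prod.cong refl arg_cong2[where f = power] scale) (auto simp: indets_def)
    also have "\<dots> = c ^ mdeg m * (\<Prod>v \<in> Poly_Mapping.keys m. \<tau> v ^ Poly_Mapping.lookup m v)"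
      by (simp add: power_mult_distrib prod.distrib wdeg_def power_sum)
    finally show ?thesis using form m by simp
  qed
  then show ?thesis
    by (simp add: eval_hom_def sum_distrib_left mult.left_commute)
qed

abbreviation set_one :: "indet \<Rightarrow> 'k::comm_ring_1 mpoly \<Rightarrow> 'k mpoly" where
  "set_one u \<equiv> eval_hom mconst (\<lambda>v. if v = u then 1 else mvar v)"

lemma unital_hom_set_one: "unital_hom (set_one u :: 'k::comm_ring_1 mpoly \<Rightarrow> 'k mpoly)"
  by (rule unital_hom_eval_hom[OF unital_hom_mconst])

lemma set_one_homog:
  fixes f :: "'k::comm_ring_1 mpoly"
  assumes "u \<notin> indets f"
  shows "set_one u (homog u f) = f"
proof -
  interpret unital_hom "set_one u :: 'k mpoly \<Rightarrow> 'k mpoly" by (rule unital_hom_set_one)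
  have single: "set_one u (Poly_Mapping.single (m + Poly_Mapping.single u k) c) =
      Poly_Mapping.single m c"
    if m: "u \<notin> Poly_Mapping.keys m" for m k and c :: 'k
  proof -
    have "Poly_Mapping.single (m + Poly_Mapping.single u k) c =
        Poly_Mapping.single m c * mvar u ^ k"
      by (simp add: mvar_power mult_single)
    moreover have "set_one u (Poly_Mapping.single m c) = Poly_Mapping.single m c"
      using m indets_single[of m c] by (intro eval_hom_mvar_ident) auto
    ultimately show ?thesis by (simp add: hom_mult hom_power eval_mconst_simps)
  qed
  have "set_one u (homog u f) =
      (\<Sum>m \<in> Poly_Mapping.keys f. Poly_Mapping.single m (Poly_Mapping.lookup f m))"
    unfolding homog_def hom_sum using assms
    by (intro sum.cong refl single) (auto simp: indets_def)
  then show ?thesis by (simp add: mpoly_eq_sum[of f, symmetric])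
qed

lemma set_one_shifted_homog:
  fixes f :: "'k::comm_ring_1 mpoly"
  assumes "u \<notin> indets f"
  shows "set_one u (shifted_homog d u f) = f"
proof -
  interpret unital_hom "set_one u :: 'k mpoly \<Rightarrow> 'k mpoly" by (rule unital_hom_set_one)
  show ?thesis
    by (simp add: shifted_homog_def hom_mult hom_power eval_mconst_simps set_one_homog[OF assms])
qed

lemma shifted_homog_form:
  assumes "tdeg f \<le> d"
  shows "\<forall>m \<in> Poly_Mapping.keys (shifted_homog d v f). mdeg m = d"
proof
  fix m assume "m \<in> Poly_Mapping.keys (shifted_homog d v f)"
  from shifted_homog_keys[OF assms this] obtain m' where
    "mdeg m' \<le> d" "m = m' + Poly_Mapping.single v (d - mdeg m')" .
  then show "mdeg m = d" by (simp add: wdeg_add)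
qed

lemma homog_eq_shifted_homog: "homog v f = shifted_homog (tdeg f) v f"
  by (simp add: shifted_homog_def)

lemma indets_shifted_homog:
  assumes "tdeg f \<le> d"
  shows "indets (shifted_homog d v f) \<subseteq> insert v (indets f)"
proof
  fix w assume "w \<in> indets (shifted_homog d v f)"
  then obtain m where m: "m \<in> Poly_Mapping.keys (shifted_homog d v f)" "w \<in> Poly_Mapping.keys m"
    by (auto simp: indets_def)
  from shifted_homog_keys[OF assms m(1)] obtain m' where "m' \<in> Poly_Mapping.keys f"
    "m = m' + Poly_Mapping.single v (d - mdeg m')" by metis
  then show "w \<in> insert v (indets f)"
    using m(2) by (auto simp: indets_def keys_plus_monomial split: if_splits)
qed

text \<open>Setting \<open>u = 1\<close> is injective on forms of a given degree. Over the field of fractions a form of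
  degree \<open>N\<close> is \<open>u\<^sup>N\<close> times its value at the quotients \<open>v/u\<close>; since \<open>u/u = 1\<close>, that value depends
  on the dehomogenized form only.\<close>

lemma set_one_eq_0_form:
  fixes g :: "'k::field mpoly"
  assumes form: "\<forall>m \<in> Poly_Mapping.keys g. mdeg m = N" and zero: "set_one u g = 0"
  shows "g = 0"
proof -
  let ?\<iota> = "\<lambda>f :: 'k mpoly. Fraction_Field.Fract f 1"
  have "?\<iota> (mvar u) \<noteq> 0"
    using indets_mvar[of u, where 'k = 'k] by (auto simp: Fract_eq_0_iff)
  define \<tau> where "\<tau> v = ?\<iota> (mvar v) / ?\<iota> (mvar u)" for v
  have \<tau>: "?\<iota> (mvar v) = ?\<iota> (mvar u) * \<tau> v" "\<tau> u = 1" for v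
    using \<open>?\<iota> (mvar u) \<noteq> 0\<close>
    by (simp_all only: \<tau>_def times_divide_eq_right nonzero_mult_div_cancel_left divide_self
        not_False_eq_True)
  have hom: "unital_hom (eval_hom ratconst \<tau>)"
    by (rule unital_hom_eval_hom[OF unital_hom_ratconst])
  have "eval_hom ratconst \<tau> g = eval_hom ratconst \<tau> (set_one u g)"
    by (rule unital_hom_cong_indets[OF hom unital_hom_comp[OF unital_hom_set_one hom]])
      (simp_all add: eval_mconst_simps eval_hom_mconst[OF unital_hom_ratconst]
        eval_hom_mvar[OF unital_hom_ratconst] unital_hom.hom_one[OF hom] \<tau>(2))
  then have "eval_hom ratconst \<tau> g = 0"
    by (simp add: zero unital_hom.hom_zero[OF hom])
  moreover have "?\<iota> g = ?\<iota> (mvar u) ^ N * eval_hom ratconst \<tau> g"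
    unfolding Fract_eq_eval_hom[of g] by (intro eval_hom_form_scale[OF form] \<tau>(1))
  ultimately show ?thesis by (simp add: Fract_eq_0_iff)
qed

section \<open>Graph ideals\<close>

text \<open>The kernel is the preimage of the zero ideal of a domain.\<close>

lemma primeideal_kernel:
  fixes \<chi> :: "'k::field mpoly \<Rightarrow> 'k mpoly"
  assumes "unital_hom \<chi>"
  shows "primeideal {f. indets f \<subseteq> V \<and> \<chi> f = 0} (mpoly_ring V)"
proof -
  let ?S = "mpoly_ring UNIV :: 'k mpoly ring"
  interpret R: cring "mpoly_ring V :: 'k mpoly ring" by (rule cring_mpoly_ring)
  interpret S: cring ?S by (rule cring_mpoly_ring)
  interpret \<chi>: unital_hom \<chi> by fact
  interpret h: ring_hom_ring "mpoly_ring V" ?S \<chi>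
    by (rule ring_hom_ringI)
      (simp_all add: R.ring_axioms S.ring_axioms \<chi>.hom_add \<chi>.hom_mult \<chi>.hom_one)
  have "domain ?S" by unfold_locales auto
  then have "primeideal {\<zero>\<^bsub>?S\<^esub>} ?S" by (rule domain.zeroprimeideal)
  from h.primeideal_vimage[OF cring_mpoly_ring this] show ?thesis by simp
qed

definition subst_x :: "(nat \<Rightarrow> 'k mpoly) \<Rightarrow> 'k mpoly \<Rightarrow> 'k::comm_ring_1 mpoly" where
  "subst_x P = eval_hom mconst (\<lambda>v. case v of X i \<Rightarrow> P i | _ \<Rightarrow> mvar v)"

lemma unital_hom_subst_x: "unital_hom (subst_x P)"
  unfolding subst_x_def by (rule unital_hom_eval_hom[OF unital_hom_mconst])

lemma subst_x_mvar: "subst_x P (mvar v) = (case v of X i \<Rightarrow> P i | _ \<Rightarrow> mvar v)"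
  by (simp add: subst_x_def eval_mconst_simps)

lemma subst_x_mconst: "subst_x P (mconst c) = mconst c"
  by (simp add: subst_x_def eval_mconst_simps)

lemma subst_x_ident:
  assumes "indets f \<inter> range X = {}"
  shows "subst_x P f = f"
  unfolding subst_x_def using assms
  by (intro eval_hom_mvar_ident) (auto split: indet.split)

text \<open>The ideal of the graph of \<open>x\<^sub>i \<mapsto> P\<^sub>i\<close>. The polynomials \<open>f\<close> congruent to \<open>subst_x P f\<close> modulo
  \<open>J\<close> are closed under sums and products and contain the constants and indeterminates; hence all of
  \<open>K[V]\<close> has this property, and \<open>subst_x P f = 0\<close> forces \<open>f \<in> J\<close>. The other inclusion holds because
  \<open>subst_x P\<close> kills the generators, as the \<open>P\<^sub>i\<close> do not involve the \<open>x\<^sub>i\<close>.\<close>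

lemma graph_ideal_eq_kernel:
  fixes P :: "nat \<Rightarrow> 'k::field mpoly"
  assumes W: "W \<inter> range X = {}" and P: "\<forall>i \<in> {0..n}. indets (P i) \<subseteq> W"
  defines "V \<equiv> x_indets 0 n \<union> W"
  defines "J \<equiv> Idl\<^bsub>mpoly_ring V\<^esub> ((\<lambda>i. mvar (X i) - P i) ` {0..n})"
  shows "J = {f. indets f \<subseteq> V \<and> subst_x P f = 0}"
    and "\<And>f. indets f \<subseteq> V \<Longrightarrow> indets (subst_x P f) \<subseteq> W"
    and "\<And>f. indets f \<subseteq> V \<Longrightarrow> f - subst_x P f \<in> J"
proof -
  interpret R: cring "mpoly_ring V :: 'k mpoly ring" by (rule cring_mpoly_ring)
  interpret \<Psi>: unital_hom "subst_x P" by (rule unital_hom_subst_x)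
  let ?S = "(\<lambda>i. mvar (X i) - P i) ` {0..n}"
  let ?ker = "{f. indets f \<subseteq> V \<and> subst_x P f = 0}"
  have indets_S: "indets (mvar (X i) - P i) \<subseteq> V" if "i \<in> {0..n}" for i
    using indets_diff[of "mvar (X i)" "P i"] P that
    unfolding V_def x_indets_def indets_mvar by blast
  then have S: "?S \<subseteq> carrier (mpoly_ring V)" by (auto simp: image_subset_iff)
  interpret J: ideal J "mpoly_ring V" unfolding J_def by (rule R.genideal_ideal[OF S])
  show subst_indets: "indets (subst_x P f) \<subseteq> W" if "indets f \<subseteq> V" for f
    unfolding subst_x_def
  proof (rule indets_eval_hom)
    fix v assume "v \<in> indets f"
    with that consider i where "v = X i" "i \<in> {0..n}" | "v \<in> W" "v \<notin> range X"
      using W unfolding V_def x_indets_def by blast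
    then show "indets (case v of X i \<Rightarrow> P i | _ \<Rightarrow> mvar v) \<subseteq> W"
      by cases (use P in \<open>auto simp: indets_mvar split: indet.split\<close>)
  qed
  have addJ: "f + g \<in> J" if "f \<in> J" "g \<in> J" for f g
    using J.a_closed[OF that] by simp
  have multJ: "r * f \<in> J" if "f \<in> J" "indets r \<subseteq> V" for f r
    using J.I_l_closed[of f r] that by simp
  have zeroJ: "0 \<in> J" using J.zero_closed by simp
  show diffJ: "f - subst_x P f \<in> J" if "indets f \<subseteq> V" for f
  proof -
    have "indets f \<subseteq> V \<and> f - subst_x P f \<in> J" using that
    proof (induction rule: mpoly_induct)
      case (var v)
      then consider i where "v = X i" "i \<in> {0..n}" | "v \<in> W" "v \<notin> range X"
        using W by (auto simp: V_def x_indets_def)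
      then show ?case
      proof cases
        case 1
        then have "mvar v - subst_x P (mvar v) \<in> J"
          using R.genideal_self[OF S] by (auto simp: J_def subst_x_mvar)
        then show ?thesis using var by (simp add: indets_mvar)
      next
        case 2
        then show ?thesis
          using var zeroJ by (simp add: indets_mvar subst_x_ident)
      qed
    next
      case (add f g)
      then have "(f - subst_x P f) + (g - subst_x P g) \<in> J" by (intro addJ) auto
      then show ?case using add indets_add[of f g] by (auto simp: \<Psi>.hom_add algebra_simps)
    next
      case (mult f g)
      then have "indets (subst_x P g) \<subseteq> V"
        using subst_indets[of g] by (auto simp: V_def)
      with mult have "f * (g - subst_x P g) + subst_x P g * (f - subst_x P f) \<in> J"
        by (intro addJ multJ) auto
      then show ?case using mult indets_mult[of f g] by (auto simp: \<Psi>.hom_mult algebra_simps)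
    qed (simp add: subst_x_mconst zeroJ)
    then show ?thesis by blast
  qed
  show "J = ?ker"
  proof
    have "ideal ?ker (mpoly_ring V)"
      using primeideal_kernel[OF unital_hom_subst_x] by (rule primeideal.axioms)
    moreover have "?S \<subseteq> ?ker"
    proof
      fix f assume "f \<in> ?S"
      then obtain i where i: "f = mvar (X i) - P i" "i \<in> {0..n}" by blast
      have "subst_x P (P i) = P i" using P i(2) W by (intro subst_x_ident) blast
      then show "f \<in> ?ker" using i indets_S by (simp add: \<Psi>.hom_minus subst_x_mvar)
    qed
    ultimately show "J \<subseteq> ?ker" unfolding J_def by (rule R.genideal_minimal)
    show "?ker \<subseteq> J" using diffJ by force
  qed
qed

section \<open>Implicitization by homogenization\<close>

lemma tdeg_eq_0D:
  fixes f :: "'k::comm_ring_1 mpoly"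
  assumes "tdeg f = 0"
  shows "f = mconst (Poly_Mapping.lookup f 0)"
proof -
  have "m = 0" if "m \<in> Poly_Mapping.keys f" for m
  proof -
    have "mdeg m = 0" using mdeg_le_tdeg[OF that] assms by simp
    then show ?thesis by (intro poly_mapping_eqI) (simp add: wdeg_def in_keys_iff)
  qed
  then show ?thesis
    by (intro poly_mapping_eqI) (auto simp: mconst_def lookup_single when_def in_keys_iff)
qed

text \<open>This makes the common degree \<open>d\<close> positive when some quotient is not constant.\<close>

lemma Fract_of_tdeg_0:
  fixes f q :: "'k::field mpoly"
  assumes "tdeg f = 0" "tdeg q = 0" "q \<noteq> 0"
  shows "Fraction_Field.Fract f q \<in> range ratconst"
proof -
  interpret unital_hom "mconst :: 'k \<Rightarrow> 'k mpoly" by (rule unital_hom_mconst)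
  define a b where "a = Poly_Mapping.lookup f 0" and "b = Poly_Mapping.lookup q 0"
  have fq: "f = mconst a" "q = mconst b"
    using tdeg_eq_0D assms by (simp_all add: a_def b_def)
  have "b \<noteq> 0" using assms(3) fq(2) hom_zero by auto
  then have "f * 1 = mconst (a / b) * q"
    unfolding fq hom_mult[symmetric] by simp
  then have "Fraction_Field.Fract f q = ratconst (a / b)"
    using assms(3) by (simp add: ratconst_def eq_fract)
  then show ?thesis by blast
qed

text \<open>In the field of fractions this reads \<open>A(q,p\<^sub>1,\<dots>,p\<^sub>n) = q\<^sup>N A(1,p\<^sub>1/q,\<dots>,p\<^sub>n/q)\<close>: setting \<open>h = 1\<close> turns the
  \<open>P\<^sub>i\<close> back into \<open>q\<close> and the \<open>p\<^sub>i\<close>, and the values \<open>q, p\<^sub>1, \<dots>, p\<^sub>n\<close> are \<open>q\<close> times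
  \<open>1, p\<^sub>1/q, \<dots>, p\<^sub>n/q\<close>.\<close>

lemma eval_form_at_quotients:
  fixes A q :: "'k::field mpoly"
  assumes form: "\<forall>m \<in> Poly_Mapping.keys A. mdeg m = N" and A: "indets A \<subseteq> x_indets 0 n"
    and "q \<noteq> 0"
    and P0: "set_one H (P 0) = q" and P: "\<And>i. i \<in> {1..n} \<Longrightarrow> set_one H (P i) = p i"
  shows "Fraction_Field.Fract (set_one H (subst_x P A)) 1 = Fraction_Field.Fract q 1 ^ N *
    eval_hom ratconst (\<lambda>v. case v of X i \<Rightarrow> Fraction_Field.Fract (p i) q | _ \<Rightarrow> 0)
      (set_one (X 0) A)"
proof -
  define \<epsilon> :: "'k mpoly \<Rightarrow> 'k ratfun" where
    "\<epsilon> = eval_hom ratconst (\<lambda>v. case v of X i \<Rightarrow> Fraction_Field.Fract (p i) q | _ \<Rightarrow> 0)"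
  let ?\<sigma> = "\<lambda>v. case v of X i \<Rightarrow> Fraction_Field.Fract (if i = 0 then q else p i) 1 | _ \<Rightarrow> 0"
  let ?\<tau> = "\<lambda>v. case v of X i \<Rightarrow> Fraction_Field.Fract (if i = 0 then q else p i) q | _ \<Rightarrow> 0"
  note hom = unital_hom_eval_hom[OF unital_hom_ratconst]
  note rat = eval_hom_mconst[OF unital_hom_ratconst] eval_hom_mvar[OF unital_hom_ratconst]
  have \<epsilon>: "unital_hom \<epsilon>" unfolding \<epsilon>_def by (rule hom)
  have x: "\<exists>i. v = X i \<and> (i = 0 \<or> i \<in> {1..n})" if "v \<in> indets A" for v
    using that A by (fastforce simp: x_indets_def)
  have "Fraction_Field.Fract (set_one H (subst_x P A)) 1 = eval_hom ratconst ?\<sigma> A"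
    by (rule unital_hom_cong_indets[OF unital_hom_comp[OF unital_hom_subst_x
            unital_hom_comp[OF unital_hom_set_one unital_hom_Fract]] hom])
      (use x in \<open>fastforce simp: subst_x_mconst subst_x_mvar eval_mconst_simps rat ratconst_def P0 P\<close>)+
  also have "\<dots> = Fraction_Field.Fract q 1 ^ N * eval_hom ratconst ?\<tau> A"
    using \<open>q \<noteq> 0\<close> by (intro eval_hom_form_scale[OF form])
      (auto simp: eq_fract Zero_fract_def split: indet.split)
  also have "eval_hom ratconst ?\<tau> A = \<epsilon> (set_one (X 0) A)"
  proof (rule unital_hom_cong_indets[OF hom unital_hom_comp[OF unital_hom_set_one \<epsilon>]])
    fix v assume "v \<in> indets A"
    from x[OF this] obtain i where i: "v = X i" by blast
    show "eval_hom ratconst ?\<tau> (mvar v) = \<epsilon> (set_one (X 0) (mvar v))"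
    proof (cases "i = 0")
      case True
      then show ?thesis
        using \<open>q \<noteq> 0\<close> i
        by (simp add: eval_mconst_simps rat unital_hom.hom_one[OF \<epsilon>] One_fract_def eq_fract)
    next
      case False
      then show ?thesis using i by (simp add: eval_mconst_simps rat \<epsilon>_def)
    qed
  qed (simp add: eval_mconst_simps rat \<epsilon>_def)
  finally show ?thesis by (simp add: \<epsilon>_def)
qed

lemma keys_wcomp:
  "m \<in> Poly_Mapping.keys (wcomp w j f) \<longleftrightarrow> m \<in> Poly_Mapping.keys f \<and> wdeg w m = j"
  by (simp add: in_keys_iff lookup_wcomp)

lemma indets_wcomp: "indets (wcomp w j f) \<subseteq> indets f"
  unfolding indets_def by (auto simp: keys_wcomp)

lemma wdeg_grading_x:
  assumes "Poly_Mapping.keys m \<subseteq> x_indets 0 n"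
  shows "wdeg (grading d) m = d * mdeg m"
proof -
  have "wdeg (grading d) m = wdeg (\<lambda>_. d) m"
    using assms by (intro wdeg_cong) (auto simp: x_indets_def)
  then show ?thesis by (simp add: wdeg_def sum_distrib_left)
qed

theorem theorem5p3:
  fixes q :: "'k::field mpoly" and p :: "nat \<Rightarrow> 'k mpoly" and n s d :: nat
  assumes "n \<ge> 1"
    and "q \<in> carrier (mpoly_ring (t_indets s))" and "q \<noteq> 0"
    and "\<forall>i \<in> {1..n}. p i \<in> carrier (mpoly_ring (t_indets s)) \<and> p i \<noteq> 0"
    and "\<forall>i \<in> {1..n}. Fraction_Field.Fract (p i) q \<notin> range ratconst"
    and "d = Max (insert (tdeg q) ((\<lambda>i. tdeg (p i)) ` {1..n}))"
  shows "primeideal (Jbar n s d p q \<inter> carrier (mpoly_ring (x_indets 0 n)))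
           (mpoly_ring (x_indets 0 n))
       \<and> Implicit n s p q =
           dehom 0 (Jbar n s d p q \<inter> carrier (mpoly_ring (x_indets 0 n)))"
proof -
  define W where "W = insert H (t_indets s)"
  define P where "P i = shifted_homog d H (if i = 0 then q else p i)" for i
  define \<epsilon> :: "'k mpoly \<Rightarrow> 'k ratfun" where
    "\<epsilon> = eval_hom ratconst (\<lambda>v. case v of X i \<Rightarrow> Fraction_Field.Fract (p i) q | _ \<Rightarrow> 0)"
  let ?J = "Jbar n s d p q"
  let ?I = "?J \<inter> carrier (mpoly_ring (x_indets 0 n))"
  interpret \<Psi>: unital_hom "subst_x P" by (rule unital_hom_subst_x)
  interpret \<epsilon>: unital_hom \<epsilon>
    unfolding \<epsilon>_def by (rule unital_hom_eval_hom[OF unital_hom_ratconst])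
  interpret deh: unital_hom "set_one (X 0) :: 'k mpoly \<Rightarrow> 'k mpoly" by (rule unital_hom_set_one)
  interpret deh_H: unital_hom "set_one H :: 'k mpoly \<Rightarrow> 'k mpoly" by (rule unital_hom_set_one)

  have deg: "tdeg q \<le> d" "\<And>i. i \<in> {1..n} \<Longrightarrow> tdeg (p i) \<le> d"
    unfolding assms(6) by (rule Max_ge; simp)+
  have q: "indets q \<subseteq> t_indets s" and p: "\<And>i. i \<in> {1..n} \<Longrightarrow> indets (p i) \<subseteq> t_indets s"
    using assms(2,4) by auto
  have "d > 0"
  proof (rule ccontr)
    assume "\<not> d > 0"
    then have "tdeg q = 0" "tdeg (p 1) = 0" using deg(1) deg(2)[of 1] \<open>n \<ge> 1\<close> by auto
    from Fract_of_tdeg_0[OF this(2,1) \<open>q \<noteq> 0\<close>] show False using assms(5) \<open>n \<ge> 1\<close> by auto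
  qed
  have "H \<notin> t_indets s" by (auto simp: t_indets_def)
  then have P_at_1: "set_one H (P 0) = q" "\<And>i. i \<in> {1..n} \<Longrightarrow> set_one H (P i) = p i"
    using q p by (auto simp: P_def intro!: set_one_shifted_homog)
  have W: "W \<inter> range X = {}" by (auto simp: W_def t_indets_def)
  have V: "all_indets n s = x_indets 0 n \<union> W"
    by (auto simp: all_indets_def W_def)
  have P_indets: "\<forall>i \<in> {0..n}. indets (P i) \<subseteq> W"
  proof
    fix i assume i: "i \<in> {0..n}"
    show "indets (P i) \<subseteq> W"
    proof (cases "i = 0")
      case True
      then show ?thesis using indets_shifted_homog[OF deg(1), of H] q by (auto simp: P_def W_def)
    next
      case False
      then show ?thesis
        using i indets_shifted_homog[OF deg(2), of i H] p[of i] by (auto simp: P_def W_def)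
    qed
  qed
  have insert_0: "{0..n} = insert 0 {1..n}" by auto
  have x_insert: "x_indets 0 n = insert (X 0) (x_indets 1 n)"
    unfolding x_indets_def insert_0 by simp
  from insert_0 have J_gen: "?J =
      Idl\<^bsub>mpoly_ring (x_indets 0 n \<union> W)\<^esub> ((\<lambda>i. mvar (X i) - P i) ` {0..n})"
    unfolding Jbar_def V by (auto simp: P_def intro!: arg_cong2[where f = genideal])
  note graph = graph_ideal_eq_kernel[where P = P and n = n, OF W P_indets, folded J_gen]
  have I_eq: "?I = {f. indets f \<subseteq> x_indets 0 n \<and> subst_x P f = 0}"
    unfolding graph(1) by auto
  have J_hom: "wcomp (grading d) j f \<in> ?J" if "f \<in> ?J" for f j
    using homogeneous_ideal_Jbar[of q s d n p] assms(2,4) deg that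
    by (auto simp: homogeneous_ideal_def)
  have Implicit_eq: "Implicit n s p q = {f. indets f \<subseteq> x_indets 1 n \<and> \<epsilon> f = 0}"
    by (simp add: Implicit_def a_kernel_def' ratfun_field_def \<epsilon>_def)
  have at_quotients: "Fraction_Field.Fract (set_one H (subst_x P A)) 1 =
      Fraction_Field.Fract q 1 ^ N * \<epsilon> (set_one (X 0) A)"
    if "\<forall>m \<in> Poly_Mapping.keys A. mdeg m = N" "indets A \<subseteq> x_indets 0 n" for A N
    unfolding \<epsilon>_def using that \<open>q \<noteq> 0\<close> P_at_1 by (rule eval_form_at_quotients)

  have prime: "primeideal ?I (mpoly_ring (x_indets 0 n))"
    unfolding I_eq by (rule primeideal_kernel[OF unital_hom_subst_x])

  have dehom_sub: "set_one (X 0) A \<in> Implicit n s p q" if A: "A \<in> ?I" for A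
  proof -
    have A_x: "indets A \<subseteq> x_indets 0 n" using A by simp
    \<comment> \<open>The component of weight \<open>j\<close> is a form of degree \<open>j div d\<close>, and zero unless \<open>d\<close> divides
      \<open>j\<close>.\<close>
    have comp_0: "\<epsilon> (set_one (X 0) (wcomp (grading d) j A)) = 0" for j
    proof -
      let ?B = "wcomp (grading d) j A"
      have B_x: "indets ?B \<subseteq> x_indets 0 n"
        using A_x indets_wcomp by blast
      have "mdeg m = j div d" if "m \<in> Poly_Mapping.keys ?B" for m
      proof -
        have "Poly_Mapping.keys m \<subseteq> x_indets 0 n" using B_x that by (auto simp: indets_def)
        then have "d * mdeg m = j" using that by (simp add: wdeg_grading_x keys_wcomp)
        then show ?thesis using \<open>d > 0\<close> by auto
      qed
      moreover have "subst_x P ?B = 0" using J_hom[of A] A graph(1) by blast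
      ultimately have "Fraction_Field.Fract q 1 ^ (j div d) * \<epsilon> (set_one (X 0) ?B) = 0"
        using at_quotients[of ?B "j div d"] B_x
        by (simp add: deh_H.hom_zero Zero_fract_def[symmetric])
      then show ?thesis using \<open>q \<noteq> 0\<close> by (simp add: Fract_eq_0_iff)
    qed
    have "A = (\<Sum>j \<in> wdeg (grading d) ` Poly_Mapping.keys A. wcomp (grading d) j A)"
      by (rule poly_mapping_eqI) (auto simp: lookup_sum lookup_wcomp in_keys_iff)
    from arg_cong[OF this, of "\<lambda>B. \<epsilon> (set_one (X 0) B)"]
    have "\<epsilon> (set_one (X 0) A) = 0" by (simp add: deh.hom_sum \<epsilon>.hom_sum comp_0)
    moreover have "indets (set_one (X 0) A) \<subseteq> x_indets 1 n"
      using A_x unfolding x_insert by (intro indets_eval_hom) (auto simp: indets_mvar)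
    ultimately show ?thesis by (simp add: Implicit_eq)
  qed

  have homog_mem: "homog (X 0) f \<in> ?I \<and> set_one (X 0) (homog (X 0) f) = f"
    if f: "f \<in> Implicit n s p q" for f
  proof -
    define F where "F = homog (X 0) f"
    define G where "G = subst_x P F"
    have f_x: "indets f \<subseteq> x_indets 1 n" and f_0: "\<epsilon> f = 0" using f by (auto simp: Implicit_eq)
    have "X 0 \<notin> indets f" using f_x by (auto simp: x_indets_def)
    then have deh_F: "set_one (X 0) F = f" unfolding F_def by (rule set_one_homog)
    have F_form: "\<forall>m \<in> Poly_Mapping.keys F. mdeg m = tdeg f"
      unfolding F_def homog_eq_shifted_homog by (rule shifted_homog_form) simp
    have "indets F \<subseteq> insert (X 0) (indets f)"
      unfolding F_def homog_eq_shifted_homog by (rule indets_shifted_homog) simp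
    then have F_x: "indets F \<subseteq> x_indets 0 n" using f_x unfolding x_insert by blast
    have "Fraction_Field.Fract (set_one H G) 1 = 0"
      unfolding G_def by (simp add: at_quotients[OF F_form F_x] deh_F f_0)
    then have G_at_1: "set_one H G = 0" by (simp add: Fract_eq_0_iff)
    have G_W: "indets G \<subseteq> W" unfolding G_def using F_x by (intro graph(2)) auto
    have FG: "F - G \<in> ?J" unfolding G_def using F_x by (intro graph(3)) auto
    \<comment> \<open>\<open>G\<close> is homogeneous because \<open>Jbar\<close> is: the component of degree \<open>D\<close> of \<open>F - G\<close> is \<open>F\<close> minus
      that of \<open>G\<close>, and the substitution, which fixes polynomials in the \<open>t\<^sub>i\<close> and \<open>h\<close>, kills it.\<close>
    define D where "D = d * tdeg f"
    have "wcomp (grading d) D F = F"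
    proof (rule poly_mapping_eqI)
      fix m
      have "wdeg (grading d) m = D" if "m \<in> Poly_Mapping.keys F"
        using that F_form F_x wdeg_grading_x[of m n d] by (auto simp: D_def indets_def)
      then show "Poly_Mapping.lookup (wcomp (grading d) D F) m = Poly_Mapping.lookup F m"
        by (auto simp: lookup_wcomp in_keys_iff)
    qed
    moreover have "wcomp (grading d) D (F - G) \<in> ?J" using FG by (rule J_hom)
    moreover have "wcomp (grading d) D (F - G) = wcomp (grading d) D F - wcomp (grading d) D G"
      using wcomp_add[of _ _ F "- G"] by (simp add: wcomp_uminus)
    ultimately have "subst_x P (F - wcomp (grading d) D G) = 0" using graph(1) by auto
    moreover have G'_W: "indets (wcomp (grading d) D G) \<subseteq> W"
      using G_W indets_wcomp by blast
    then have "subst_x P (wcomp (grading d) D G) = wcomp (grading d) D G"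
      using W by (intro subst_x_ident) blast
    ultimately have G_comp: "G = wcomp (grading d) D G" by (simp add: \<Psi>.hom_minus G_def)
    have "\<forall>m \<in> Poly_Mapping.keys G. mdeg m = D"
    proof
      fix m assume m: "m \<in> Poly_Mapping.keys G"
      then have "wdeg (grading d) m = D"
        by (subst (asm) G_comp) (simp add: keys_wcomp)
      moreover have "Poly_Mapping.keys m \<subseteq> W"
        using m G_W by (auto simp: indets_def)
      then have "wdeg (grading d) m = mdeg m"
        by (intro wdeg_cong) (auto simp: W_def t_indets_def)
      ultimately show "mdeg m = D" by simp
    qed
    then have "G = 0" using G_at_1 by (rule set_one_eq_0_form)
    then have "F \<in> ?I" using F_x unfolding I_eq by (simp add: G_def)
    then show ?thesis using deh_F by (simp add: F_def)
  qed

  have "Implicit n s p q = dehom 0 ?I"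
  proof
    show "Implicit n s p q \<subseteq> dehom 0 ?I"
    proof
      fix f assume "f \<in> Implicit n s p q"
      from homog_mem[OF this] show "f \<in> dehom 0 ?I"
        unfolding dehom_def by (intro image_eqI[of _ _ "homog (X 0) f"]) simp_all
    qed
    show "dehom 0 ?I \<subseteq> Implicit n s p q"
      unfolding dehom_def by (intro image_subsetI dehom_sub)
  qed
  with prime show ?thesis by blast
qed

end
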